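(* Let $p,q$ be complex numbers. The generating function of the odd-indexed $(p,q)$-Pell Lucas numbers is, as a formal power series in $z$, $$\sum_{n=0}^{\infty}Q_{p,q,2n+1}z^n=\frac{2p+2pqz}{1-2(2p^2+q)z+q^2z^2}.$$
   Context: The $(p,q)$-Pell Lucas numbers are defined by $Q_{p,q,0}=2$, $Q_{p,q,1}=2p$, and $Q_{p,q,n}=2pQ_{p,q,n-1}+qQ_{p,q,n-2}$ for $n\ge 2$. *)

theory Defs
  imports Complex_Main "HOL-Computational_Algebra.Formal_Power_Series"
begin

fun pell_lucas :: "complex \<Rightarrow> complex \<Rightarrow> nat \<Rightarrow> complex" where
  "pell_lucas p q 0 = 2"
| "pell_lucas p q (Suc 0) = 2 * p"
| "pell_lucas p q (Suc (Suc n)) = 2 * p * pell_lucas p q (Suc n) + q * pell_lucas p q n"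

end

theory Submission
  imports Defs
begin

text \<open>If a, b are the roots of x^2 = 2px + q, then a^2 + b^2 = 2(2p^2 + q) and (ab)^2 = q^2,
  so every second term obeys the recurrence in \<open>pell_lucas_step_2\<close>; formally, the
  original recurrence is just unfolded. The denominator is its reversed characteristic polynomial,
  so multiplying the series by it leaves only the coefficients 0 and 1.\<close>

lemma pell_lucas_step_2:
  "pell_lucas p q (Suc (Suc (Suc (Suc n)))) =
     2 * (2 * p\<^sup>2 + q) * pell_lucas p q (Suc (Suc n)) - q\<^sup>2 * pell_lucas p q n"
  by (simp add: algebra_simps power2_eq_square)

theorem theorem9:
  fixes p q :: complex
  shows "Abs_fps (\<lambda>n. pell_lucas p q (2 * n + 1)) =
    (fps_const (2 * p) + fps_const (2 * p * q) * fps_X) /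
    (1 - fps_const (2 * (2 * p\<^sup>2 + q)) * fps_X + fps_const (q\<^sup>2) * fps_X\<^sup>2)"
proof -
  define F where "F = Abs_fps (\<lambda>n. pell_lucas p q (2 * n + 1))"
  define D where "D = 1 - fps_const (2 * (2 * p\<^sup>2 + q)) * fps_X + fps_const (q\<^sup>2) * fps_X\<^sup>2"
  define N where "N = fps_const (2 * p) + fps_const (2 * p * q) * fps_X"
  have "F * D = F - fps_const (2 * (2 * p\<^sup>2 + q)) * (F * fps_X) + fps_const (q\<^sup>2) * (F * fps_X\<^sup>2)"
    by (simp add: D_def algebra_simps)
  also have "\<dots> = N"
  proof (rule fps_ext)
    fix n :: nat
    \<comment> \<open>Multiplication by a quadratic reaches back two coefficients, so the recurrence
      applies only from index 2 on.\<close>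
    consider "n = 0" | "n = 1" | m where "n = m + 2"
      by (metis One_nat_def add_2_eq_Suc' nat.exhaust)
    then show "fps_nth (F - fps_const (2 * (2 * p\<^sup>2 + q)) * (F * fps_X)
        + fps_const (q\<^sup>2) * (F * fps_X\<^sup>2)) n = fps_nth N n"
    proof cases
      case 3
      then show ?thesis
        \<comment> \<open>The coefficient vanishes by the two-step recurrence at index 2m + 1; the
          defining recurrence is disabled so that it does not unfold the terms first.\<close>
        by (simp add: F_def N_def fps_X_power_mult_right_nth pell_lucas_step_2
              del: pell_lucas.simps(3))
    \<comment> \<open>The initial values: Q_1 = 2p and Q_3 - 2(2p^2 + q) Q_1 = 2pq.\<close>
    qed (simp_all add: F_def N_def fps_X_power_mult_right_nth
          numeral_3_eq_3 power2_eq_square algebra_simps)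
  qed
  finally have "F * D = N" .
  \<comment> \<open>The constant coefficient of \<open>D\<close> is 1; being nonzero is what
    cancelling \<open>D\<close> in the quotient requires.\<close>
  moreover have "D \<noteq> 0"
  proof
    assume "D = 0"
    then have "fps_nth D 0 = 0" by simp
    then show False by (simp add: D_def)
  qed
  ultimately have "F = N / D"
    by (metis nonzero_mult_div_cancel_right)
  then show ?thesis
    by (simp only: F_def D_def N_def)
qed

end
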